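(* Let $L$ be an oriented singular link and $T$ a finite singquandle. Setting $s_i=t_i=0$ for $i=1,2,3$ in the subsingquandle polynomial invariant $\phi_{Ssqp}(L,T)$ (that is, in the polynomials that occur as exponents of $u$) yields $$\sum_{f\in \mathrm{Hom}(\mathcal{SQ}(L),T)} u^0=|\mathrm{Hom}(\mathcal{SQ}(L),T)|,$$ the singquandle counting invariant of $L$ with respect to $T$.
   Context: A quandle is a set $X$ with a binary operation $*$ such that (i) $x*x=x$ for all $x\in X$; (ii) for all $y,z\in X$ there is a unique $x\in X$ with $x*y=z$, and this $x$ is denoted $z\,\bar{*}\,y$; (iii) $(x*y)*z=(x*z)*(y*z)$ for all $x,y,z\in X$. A singquandle (short for oriented singquandle) is a quadruple $(X,*,R_1,R_2)$ where $(X,* )$ is a quandle and $R_1,R_2:X\times X\to X$ are maps such that for all $a,b,c\in X$: $$R_1(a\bar{*}b,c)*b=R_1(a,c*b),$$ $$R_2(a\bar{*}b,c)=R_2(a,c*b)\bar{*}b,$$ $$(b\bar{*}R_1(a,c))*a=(b*R_2(a,c))\bar{*}c,$$ $$R_2(a,b)=R_1(b,a*b),$$ $$R_1(a,b)*R_2(a,b)=R_2(b,a*b).$$ A homomorphism of singquandles is a map $f$ that preserves the three operations: $f(x*y)=f(x)\triangleright f(y)$, $f(R_1(x,y))=R'_1(f(x),f(y))$, $f(R_2(x,y))=R'_2(f(x),f(y))$. A subsingquandle of $X$ is a subset $M\subset X$ that is itself a singquandle under the operations of $X$ (in particular it is closed under $*,R_1,R_2$). The image of a singquandle homomorphism is a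 subsingquandle of the target. Fundamental singquandle: Let $D$ be a diagram of an oriented singular link $L$, and let $S=\{a_1,\dots,a_m\}$ be the set of arcs of $D$, where arcs end at undercrossings of classical crossings and at singular crossings. The fundamental singquandle $\mathcal{SQ}(L)$ is the quotient of the free singquandle on $S$ by the equivalence relation generated by the following crossing relations. At a positive classical crossing with incoming under-arc $x$ and over-arc $y$, the outgoing under-arc equals $x*y$; at a negative classical crossing it equals $x\,\bar{*}\,y$. At a singular crossing drawn with both strands oriented downward, with incoming top-left arc $x$ and incoming top-right arc $y$, the outgoing bottom-left arc equals $R_1(x,y)$ and the outgoing bottom-right arc equals $R_2(x,y)$. Different diagrams of $L$ are related by generalized (singular) Reidemeister moves, which correspond to the singquandle axioms, so $\mathcal{SQ}(L)$ is well defined. $\mathrm{Hom}(\mathcal{SQ}(L),T)$ denotes the set of singquandle homomorphisms from $\mathcal{SQ}(L)$ to $T$; its cardinality is called the singquandle counting invariant. For a finite singquandle $(X,*,R_1,R_2)$ and $x\in X$ define $r^1(x)=|\{y\in X\mid x*y=x\}|$, $c^1(x)=|\{y\in X \mid y*x=y\}|$, $r^2(x)=|\{y\in X\mid R_1(x,y)=x\}|$, $c^2(x)=|\{y\in X \mid R_1(y,x)=y\}|$, $r^3(x)=|\{y\in X\mid R_2(x,y)=x\}|$, $c^3(x)=|\{y\in X \mid R_2(y,x)=y\}|$. For a subsingquandle $S\subset X$ the subsingquandle polynomial is $$Ssqp(S\subset X)=\sum_{x\in S} s_1^{r^1(x)}t_1^{c^1(x)}s_2^{r^2(x)}t_2^{c^2(x)}s_3^{r^3(x)}t_3^{c^3(x)},$$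 where $r^i(x),c^i(x)$ are computed in $X$. The subsingquandle polynomial invariant of $L$ with respect to $T$, in polynomial form with formal variable $u$, is $$\phi_{Ssqp}(L,T)=\sum_{f\in \mathrm{Hom}(\mathcal{SQ}(L),T)} u^{Ssqp(\mathrm{Im}(f)\subset T)}.$$ *)

theory Defs
  imports "HOL-Analysis.Analysis" "HOL-Library.Poly_Mapping"
begin

section \<open>Singquandles\<close>

record 'a sq_struct =
  carrier :: "'a set"
  op :: "'a \<Rightarrow> 'a \<Rightarrow> 'a"
  R1 :: "'a \<Rightarrow> 'a \<Rightarrow> 'a"
  R2 :: "'a \<Rightarrow> 'a \<Rightarrow> 'a"

definition quandle :: "'a sq_struct \<Rightarrow> bool" where
  "quandle X \<longleftrightarrow>
     (\<forall>x\<in>carrier X. \<forall>y\<in>carrier X. op X x y \<in> carrier X) \<and>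
     (\<forall>x\<in>carrier X. op X x x = x) \<and>
     (\<forall>y\<in>carrier X. \<forall>z\<in>carrier X. \<exists>!x. x \<in> carrier X \<and> op X x y = z) \<and>
     (\<forall>x\<in>carrier X. \<forall>y\<in>carrier X. \<forall>z\<in>carrier X.
        op X (op X x y) z = op X (op X x z) (op X y z))"

definition opbar :: "'a sq_struct \<Rightarrow> 'a \<Rightarrow> 'a \<Rightarrow> 'a" where
  "opbar X z y = (THE x. x \<in> carrier X \<and> op X x y = z)"

definition singquandle :: "'a sq_struct \<Rightarrow> bool" where
  "singquandle X \<longleftrightarrow> quandle X \<and>
     (\<forall>a\<in>carrier X. \<forall>b\<in>carrier X. R1 X a b \<in> carrier X \<and> R2 X a b \<in> carrier X) \<and>
     (\<forall>a\<in>carrier X. \<forall>b\<in>carrier X. \<forall>c\<in>carrier X.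
        op X (R1 X (opbar X a b) c) b = R1 X a (op X c b) \<and>
        R2 X (opbar X a b) c = opbar X (R2 X a (op X c b)) b \<and>
        op X (opbar X b (R1 X a c)) a = opbar X (op X b (R2 X a c)) c \<and>
        R2 X a b = R1 X b (op X a b) \<and>
        op X (R1 X a b) (R2 X a b) = R2 X b (op X a b))"

definition subsingquandle :: "'a set \<Rightarrow> 'a sq_struct \<Rightarrow> bool" where
  "subsingquandle M X \<longleftrightarrow> M \<subseteq> carrier X \<and> singquandle (X\<lparr>carrier := M\<rparr>)"

text \<open>Homomorphisms are extensional functions, so that two of them are equal iff they agree
  on the carrier and cardinalities of hom-sets are meaningful.\<close>

definition Hom :: "'a sq_struct \<Rightarrow> 'b sq_struct \<Rightarrow> ('a \<Rightarrow> 'b) set" where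
  "Hom X Y = {f \<in> carrier X \<rightarrow>\<^sub>E carrier Y. \<forall>x\<in>carrier X. \<forall>y\<in>carrier X.
     f (op X x y) = op Y (f x) (f y) \<and>
     f (R1 X x y) = R1 Y (f x) (f y) \<and>
     f (R2 X x y) = R2 Y (f x) (f y)}"


section \<open>Free singquandles and quotients\<close>

text \<open>\<open>gen_cong X d R\<close> is the least congruence containing \<open>R\<close>, where \<open>d\<close> plays the role of the
  inverse operation; compatibility with \<open>d\<close> is what makes the quotient satisfy the uniqueness
  part of the second quandle axiom.\<close>

inductive_set gen_cong :: "'a sq_struct \<Rightarrow> ('a \<Rightarrow> 'a \<Rightarrow> 'a) \<Rightarrow> ('a \<times> 'a) set \<Rightarrow> ('a \<times> 'a) set"
  for X :: "'a sq_struct" and d :: "'a \<Rightarrow> 'a \<Rightarrow> 'a" and R :: "('a \<times> 'a) set" where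
  base: "(a, b) \<in> R \<Longrightarrow> a \<in> carrier X \<Longrightarrow> b \<in> carrier X \<Longrightarrow> (a, b) \<in> gen_cong X d R"
| refl: "a \<in> carrier X \<Longrightarrow> (a, a) \<in> gen_cong X d R"
| sym: "(a, b) \<in> gen_cong X d R \<Longrightarrow> (b, a) \<in> gen_cong X d R"
| trans: "(a, b) \<in> gen_cong X d R \<Longrightarrow> (b, c) \<in> gen_cong X d R \<Longrightarrow> (a, c) \<in> gen_cong X d R"
| op: "(a, a') \<in> gen_cong X d R \<Longrightarrow> (b, b') \<in> gen_cong X d R \<Longrightarrow>
    (op X a b, op X a' b') \<in> gen_cong X d R"
| bar: "(a, a') \<in> gen_cong X d R \<Longrightarrow> (b, b') \<in> gen_cong X d R \<Longrightarrow>
    (d a b, d a' b') \<in> gen_cong X d R"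
| R1: "(a, a') \<in> gen_cong X d R \<Longrightarrow> (b, b') \<in> gen_cong X d R \<Longrightarrow>
    (R1 X a b, R1 X a' b') \<in> gen_cong X d R"
| R2: "(a, a') \<in> gen_cong X d R \<Longrightarrow> (b, b') \<in> gen_cong X d R \<Longrightarrow>
    (R2 X a b, R2 X a' b') \<in> gen_cong X d R"

definition quot :: "'a sq_struct \<Rightarrow> ('a \<times> 'a) set \<Rightarrow> 'a set sq_struct" where
  "quot X E = \<lparr>carrier = carrier X // E,
     op = (\<lambda>A B. \<Union>a\<in>A. \<Union>b\<in>B. E `` {op X a b}),
     R1 = (\<lambda>A B. \<Union>a\<in>A. \<Union>b\<in>B. E `` {R1 X a b}),
     R2 = (\<lambda>A B. \<Union>a\<in>A. \<Union>b\<in>B. E `` {R2 X a b})\<rparr>"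

datatype 'g sq_term = Gen 'g
  | Op "'g sq_term" "'g sq_term"
  | Bar "'g sq_term" "'g sq_term"
  | T1 "'g sq_term" "'g sq_term"
  | T2 "'g sq_term" "'g sq_term"

definition term_struct :: "'g set \<Rightarrow> 'g sq_term sq_struct" where
  "term_struct S = \<lparr>carrier = {t. set_sq_term t \<subseteq> S}, op = Op, R1 = T1, R2 = T2\<rparr>"

inductive_set sq_axioms :: "('g sq_term \<times> 'g sq_term) set" where
  "(Op a a, a) \<in> sq_axioms"
| "(Op (Bar a b) b, a) \<in> sq_axioms"
| "(Bar (Op a b) b, a) \<in> sq_axioms"
| "(Op (Op a b) c, Op (Op a c) (Op b c)) \<in> sq_axioms"
| "(Op (T1 (Bar a b) c) b, T1 a (Op c b)) \<in> sq_axioms"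
| "(T2 (Bar a b) c, Bar (T2 a (Op c b)) b) \<in> sq_axioms"
| "(Op (Bar b (T1 a c)) a, Bar (Op b (T2 a c)) c) \<in> sq_axioms"
| "(T2 a b, T1 b (Op a b)) \<in> sq_axioms"
| "(Op (T1 a b) (T2 a b), T2 b (Op a b)) \<in> sq_axioms"

definition free_cong :: "'g set \<Rightarrow> ('g sq_term \<times> 'g sq_term) set" where
  "free_cong S = gen_cong (term_struct S) Bar sq_axioms"

definition free_sq :: "'g set \<Rightarrow> 'g sq_term set sq_struct" where
  "free_sq S = quot (term_struct S) (free_cong S)"

definition free_gen :: "'g set \<Rightarrow> 'g \<Rightarrow> 'g sq_term set" where
  "free_gen S x = free_cong S `` {Gen x}"

definition sq_quot :: "'a sq_struct \<Rightarrow> ('a \<times> 'a) set \<Rightarrow> 'a set sq_struct" where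
  "sq_quot X R = quot X (gen_cong X (opbar X) R)"


section \<open>Oriented singular links and their diagrams\<close>

text \<open>A point of the parameter space is a pair (component, parameter), the components being
  circles of length 1, oriented by increasing parameter.\<close>

definition params :: "nat \<Rightarrow> (nat \<times> real) set" where
  "params n = {..<n} \<times> {0..<1}"

definition velocity :: "(nat \<Rightarrow> real \<Rightarrow> 'v) \<Rightarrow> nat \<times> real \<Rightarrow> 'v::real_normed_vector" where
  "velocity c p = vector_derivative (c (fst p)) (at (snd p))"

definition smooth_curve :: "(real \<Rightarrow> 'v::real_normed_vector) \<Rightarrow> bool" where
  "smooth_curve g \<longleftrightarrow>
     (\<forall>k t. (((\<lambda>h s. vector_derivative h (at s)) ^^ k) g) differentiable (at t))"

definition double_points :: "nat \<Rightarrow> (nat \<Rightarrow> real \<Rightarrow> 'v) \<Rightarrow> ((nat \<times> real) \<times> (nat \<times> real)) set" where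
  "double_points n c =
     {(p, q). p \<in> params n \<and> q \<in> params n \<and> p \<noteq> q \<and> c (fst p) (snd p) = c (fst q) (snd q)}"

text \<open>A smooth immersion of \<open>n\<close> circles whose only singularities are finitely many transverse
  double points.  In 3-space this describes a singular link, in the plane a generic projection.\<close>

definition generic_immersion :: "nat \<Rightarrow> (nat \<Rightarrow> real \<Rightarrow> 'v::real_normed_vector) \<Rightarrow> bool" where
  "generic_immersion n c \<longleftrightarrow>
     (\<forall>i<n. smooth_curve (c i) \<and> (\<forall>t. c i (t + 1) = c i t) \<and> (\<forall>t. velocity c (i, t) \<noteq> 0)) \<and>
     finite (double_points n c) \<and>
     (\<forall>p q r. (p, q) \<in> double_points n c \<and> (p, r) \<in> double_points n c \<longrightarrow> q = r) \<and>
     (\<forall>(p, q) \<in> double_points n c. \<forall>x y.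
        x *\<^sub>R velocity c p + y *\<^sub>R velocity c q = 0 \<longrightarrow> x = 0 \<and> y = 0)"

record sing_link =
  ncomp :: nat
  curve :: "nat \<Rightarrow> real \<Rightarrow> real ^ 3"

definition oriented_singular_link :: "sing_link \<Rightarrow> bool" where
  "oriented_singular_link L \<longleftrightarrow> ncomp L \<ge> 1 \<and> generic_immersion (ncomp L) (curve L)"

text \<open>Isotopy: a \<open>C\<^sup>1\<close>-continuous path of singular links with a constant number of double points.
  By \<open>C\<^sup>1\<close>-continuity and transversality, double points then move continuously
  and are neither created nor destroyed, so strands never pass through each other.\<close>

definition isotopic :: "sing_link \<Rightarrow> sing_link \<Rightarrow> bool" where
  "isotopic L L' \<longleftrightarrow> ncomp L = ncomp L' \<and>
     (\<exists>H :: real \<Rightarrow> nat \<Rightarrow> real \<Rightarrow> real ^ 3.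
        (\<forall>i<ncomp L. H 0 i = curve L i \<and> H 1 i = curve L' i) \<and>
        (\<forall>s\<in>{0..1}. generic_immersion (ncomp L) (H s) \<and>
           card (double_points (ncomp L) (H s)) = card (double_points (ncomp L) (curve L))) \<and>
        (\<forall>i<ncomp L.
           continuous_on ({0..1} \<times> UNIV) (\<lambda>(s, t). H s i t) \<and>
           continuous_on ({0..1} \<times> UNIV) (\<lambda>(s, t). velocity (H s) (i, t))))"

text \<open>A diagram is recorded as a singular link in general position with respect to the vertical
  projection: its shadow is the underlying plane curve, and comparing heights at the double points
  of the shadow gives the crossing information, equal heights meaning a singular crossing.\<close>

definition shadow :: "sing_link \<Rightarrow> nat \<Rightarrow> real \<Rightarrow> real ^ 2" where
  "shadow D i t = vector [curve D i t $ 1, curve D i t $ 2]"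

definition height :: "sing_link \<Rightarrow> nat \<times> real \<Rightarrow> real" where
  "height D p = curve D (fst p) (snd p) $ 3"

definition diagram :: "sing_link \<Rightarrow> bool" where
  "diagram D \<longleftrightarrow> oriented_singular_link D \<and> generic_immersion (ncomp D) (shadow D)"

definition diagram_of :: "sing_link \<Rightarrow> sing_link \<Rightarrow> bool" where
  "diagram_of D L \<longleftrightarrow> diagram D \<and> isotopic L D"

definition crossings :: "sing_link \<Rightarrow> ((nat \<times> real) \<times> (nat \<times> real)) set" where
  "crossings D = double_points (ncomp D) (shadow D)"

definition over_under :: "sing_link \<Rightarrow> nat \<times> real \<Rightarrow> nat \<times> real \<Rightarrow> bool" where
  "over_under D p q \<longleftrightarrow> (p, q) \<in> crossings D \<and> height D p > height D q"

definition singular_crossing :: "sing_link \<Rightarrow> nat \<times> real \<Rightarrow> nat \<times> real \<Rightarrow> bool" where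
  "singular_crossing D p q \<longleftrightarrow> (p, q) \<in> crossings D \<and> height D p = height D q"

definition turn :: "sing_link \<Rightarrow> nat \<times> real \<Rightarrow> nat \<times> real \<Rightarrow> real" where
  "turn D p q = det (vector [velocity (shadow D) p, velocity (shadow D) q] :: real ^ 2 ^ 2)"

definition cuts :: "sing_link \<Rightarrow> (nat \<times> real) set" where
  "cuts D = {q. \<exists>p. over_under D p q \<or> singular_crossing D p q}"

text \<open>Arcs are the components of the parameter circles minus the cuts; the integer \<open>k\<close> accounts
  for going around the circle.\<close>

definition arc_through :: "sing_link \<Rightarrow> nat \<times> real \<Rightarrow> (nat \<times> real) set" where
  "arc_through D = (\<lambda>(i, t). {(i, s) | s. s \<in> {0..<1} \<and>
     (\<exists>k::int. \<forall>r\<in>closed_segment t (s + of_int k). (i, frac r) \<notin> cuts D)})"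

definition arcs :: "sing_link \<Rightarrow> (nat \<times> real) set set" where
  "arcs D = arc_through D ` (params (ncomp D) - cuts D)"

definition incoming :: "sing_link \<Rightarrow> nat \<times> real \<Rightarrow> (nat \<times> real) set \<Rightarrow> bool" where
  "incoming D p A \<longleftrightarrow>
     A \<in> arcs D \<and> eventually (\<lambda>s. (fst p, frac s) \<in> A) (at_left (snd p))"

definition outgoing :: "sing_link \<Rightarrow> nat \<times> real \<Rightarrow> (nat \<times> real) set \<Rightarrow> bool" where
  "outgoing D p A \<longleftrightarrow>
     A \<in> arcs D \<and> eventually (\<lambda>s. (fst p, frac s) \<in> A) (at_right (snd p))"


section \<open>The fundamental singquandle\<close>

text \<open>At a classical crossing \<open>p\<close> is the over-strand and \<open>q\<close> the under-strand; the crossing is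
  positive iff the over-direction turns counterclockwise to the under-direction.
  At a singular crossing drawn with both strands downward, the strand \<open>p\<close> entering at the top left
  has direction (1,-1) and the strand \<open>q\<close> entering at the top right has direction (-1,-1), so
  \<open>turn D p q < 0\<close>; \<open>q\<close> leaves at the bottom left and \<open>p\<close> at the bottom right.\<close>

definition crossing_rels ::
  "sing_link \<Rightarrow> ((nat \<times> real) set sq_term set \<times> (nat \<times> real) set sq_term set) set" where
  "crossing_rels D =
     (let F = free_sq (arcs D); g = free_gen (arcs D) in
      {(g z, op F (g x) (g y)) | x y z. \<exists>p q. over_under D p q \<and> turn D p q > 0 \<and>
         incoming D q x \<and> y \<in> arcs D \<and> p \<in> y \<and> outgoing D q z} \<union>
      {(g z, opbar F (g x) (g y)) | x y z. \<exists>p q. over_under D p q \<and> turn D p q < 0 \<and>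
         incoming D q x \<and> y \<in> arcs D \<and> p \<in> y \<and> outgoing D q z} \<union>
      {(g z, R1 F (g x) (g y)) | x y z. \<exists>p q. singular_crossing D p q \<and> turn D p q < 0 \<and>
         incoming D p x \<and> incoming D q y \<and> outgoing D q z} \<union>
      {(g z, R2 F (g x) (g y)) | x y z. \<exists>p q. singular_crossing D p q \<and> turn D p q < 0 \<and>
         incoming D p x \<and> incoming D q y \<and> outgoing D p z})"

definition SQ :: "sing_link \<Rightarrow> (nat \<times> real) set sq_term set set sq_struct" where
  "SQ D = sq_quot (free_sq (arcs D)) (crossing_rels D)"

definition counting_invariant :: "sing_link \<Rightarrow> 'a sq_struct \<Rightarrow> nat" where
  "counting_invariant D T = card (Hom (SQ D) T)"


section \<open>The subsingquandle polynomial invariant\<close>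

datatype var = s1 | t1 | s2 | t2 | s3 | t3

text \<open>Polynomials in the six variables are finitely supported maps from monomials to coefficients.\<close>

type_synonym sqpoly = "(var \<Rightarrow>\<^sub>0 nat) \<Rightarrow>\<^sub>0 int"

definition V :: "var \<Rightarrow> sqpoly" where
  "V v = Poly_Mapping.single (Poly_Mapping.single v 1) 1"

definition eval_poly :: "(var \<Rightarrow> int) \<Rightarrow> sqpoly \<Rightarrow> int" where
  "eval_poly \<alpha> p = (\<Sum>m\<in>Poly_Mapping.keys p.
     Poly_Mapping.lookup p m * (\<Prod>v\<in>Poly_Mapping.keys m. \<alpha> v ^ Poly_Mapping.lookup m v))"

definition r1 where "r1 X x = card {y \<in> carrier X. op X x y = x}"
definition c1 where "c1 X x = card {y \<in> carrier X. op X y x = y}"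
definition r2 where "r2 X x = card {y \<in> carrier X. R1 X x y = x}"
definition c2 where "c2 X x = card {y \<in> carrier X. R1 X y x = y}"
definition r3 where "r3 X x = card {y \<in> carrier X. R2 X x y = x}"
definition c3 where "c3 X x = card {y \<in> carrier X. R2 X y x = y}"

definition Ssqp :: "'a set \<Rightarrow> 'a sq_struct \<Rightarrow> sqpoly" where
  "Ssqp S X = (\<Sum>x\<in>S. V s1 ^ r1 X x * V t1 ^ c1 X x * V s2 ^ r2 X x * V t2 ^ c2 X x *
     V s3 ^ r3 X x * V t3 ^ c3 X x)"

text \<open>Formal sums \<open>\<Sum> n\<^sub>e u^e\<close> with exponents \<open>e\<close> in an additive monoid are elements of its
  integral monoid ring.\<close>

definition u_pow :: "'e \<Rightarrow> 'e \<Rightarrow>\<^sub>0 int" where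
  "u_pow e = frag_of e"

definition phi_Ssqp :: "sing_link \<Rightarrow> 'a sq_struct \<Rightarrow> sqpoly \<Rightarrow>\<^sub>0 int" where
  "phi_Ssqp D T = (\<Sum>f\<in>Hom (SQ D) T. u_pow (Ssqp (f ` carrier (SQ D)) T))"

definition subst_exponents :: "(var \<Rightarrow> int) \<Rightarrow> (sqpoly \<Rightarrow>\<^sub>0 int) \<Rightarrow> (int \<Rightarrow>\<^sub>0 int)" where
  "subst_exponents \<alpha> P = frag_extend (\<lambda>e. u_pow (eval_poly \<alpha> e)) P"


section \<open>Consistency of the definitions\<close>

text \<open>The fundamental singquandle is a singquandle, images of homomorphisms are subsingquandles, and
  the sum defining \<open>phi_Ssqp\<close> is over a finite set.\<close>

lemma gen_cong_subset:
  assumes "\<forall>a\<in>carrier X. \<forall>b\<in>carrier X.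
      op X a b \<in> carrier X \<and> d a b \<in> carrier X \<and> R1 X a b \<in> carrier X \<and> R2 X a b \<in> carrier X"
    and "(a, b) \<in> gen_cong X d R"
  shows "a \<in> carrier X \<and> b \<in> carrier X"
  using assms(2) by induction (auto simp: assms(1))

lemma gen_cong_equiv:
  assumes "\<forall>a\<in>carrier X. \<forall>b\<in>carrier X.
      op X a b \<in> carrier X \<and> d a b \<in> carrier X \<and> R1 X a b \<in> carrier X \<and> R2 X a b \<in> carrier X"
  shows "equiv (carrier X) (gen_cong X d R)"
proof (rule equivI)
  show "gen_cong X d R \<subseteq> carrier X \<times> carrier X"
    using gen_cong_subset[of X d, OF assms] by auto
  show "refl_on (carrier X) (gen_cong X d R)"
    by (auto simp: refl_on_def intro: gen_cong.refl)
  show "Relation.sym (gen_cong X d R)" by (auto simp: sym_def intro: gen_cong.sym)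
  show "Relation.trans (gen_cong X d R)" by (meson transI gen_cong.trans)
qed

lemma quot_ops:
  fixes X :: "'a sq_struct" and d R
  defines "E \<equiv> gen_cong X d R"
  assumes cl: "\<forall>a\<in>carrier X. \<forall>b\<in>carrier X.
      op X a b \<in> carrier X \<and> d a b \<in> carrier X \<and> R1 X a b \<in> carrier X \<and> R2 X a b \<in> carrier X"
    and ab: "a \<in> carrier X" "b \<in> carrier X"
  shows "op (quot X E) (E `` {a}) (E `` {b}) = E `` {op X a b}"
    "R1 (quot X E) (E `` {a}) (E `` {b}) = E `` {R1 X a b}"
    "R2 (quot X E) (E `` {a}) (E `` {b}) = E `` {R2 X a b}"
proof -
  have eq: "equiv (carrier X) E" unfolding E_def by (rule gen_cong_equiv[OF cl])
  have c: "congruent2 E E (\<lambda>a b. E `` {f a b})"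
    if "\<And>a a' b b'. (a,a') \<in> E \<Longrightarrow> (b,b') \<in> E \<Longrightarrow> (f a b, f a' b') \<in> E" for f
    using that by (auto simp: congruent2_def intro!: equiv_class_eq[OF eq])
  have "congruent2 E E (\<lambda>a b. E `` {op X a b})"
    "congruent2 E E (\<lambda>a b. E `` {R1 X a b})"
    "congruent2 E E (\<lambda>a b. E `` {R2 X a b})"
    by (rule c; unfold E_def; blast intro: gen_cong.op gen_cong.R1 gen_cong.R2)+
  from this[THEN UN_equiv_class2[OF eq eq _ ab]]
  show "op (quot X E) (E `` {a}) (E `` {b}) = E `` {op X a b}"
    "R1 (quot X E) (E `` {a}) (E `` {b}) = E `` {R1 X a b}"
    "R2 (quot X E) (E `` {a}) (E `` {b}) = E `` {R2 X a b}"
    by (simp_all add: quot_def)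
qed

lemma quot_singquandle:
  fixes X :: "'a sq_struct" and d R
  defines "E \<equiv> gen_cong X d R"
  assumes cl: "\<forall>a\<in>carrier X. \<forall>b\<in>carrier X.
      op X a b \<in> carrier X \<and> d a b \<in> carrier X \<and> R1 X a b \<in> carrier X \<and> R2 X a b \<in> carrier X"
    and ax: "\<forall>a\<in>carrier X. \<forall>b\<in>carrier X. \<forall>c\<in>carrier X.
      (op X a a, a) \<in> E \<and> (op X (d a b) b, a) \<in> E \<and> (d (op X a b) b, a) \<in> E \<and>
      (op X (op X a b) c, op X (op X a c) (op X b c)) \<in> E \<and>
      (op X (R1 X (d a b) c) b, R1 X a (op X c b)) \<in> E \<and>
      (R2 X (d a b) c, d (R2 X a (op X c b)) b) \<in> E \<and>
      (op X (d b (R1 X a c)) a, d (op X b (R2 X a c)) c) \<in> E \<and>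
      (R2 X a b, R1 X b (op X a b)) \<in> E \<and>
      (op X (R1 X a b) (R2 X a b), R2 X b (op X a b)) \<in> E"
  shows "singquandle (quot X E)"
    and "\<And>a b. a \<in> carrier X \<Longrightarrow> b \<in> carrier X \<Longrightarrow>
      opbar (quot X E) (E `` {a}) (E `` {b}) = E `` {d a b}"
proof -
  have eq: "equiv (carrier X) E" unfolding E_def by (rule gen_cong_equiv[OF cl])
  note cl' = cl
  note cl = cl[rule_format] and ax = ax[rule_format]
  note ops = quot_ops[of X d _ _ R, OF cl', folded E_def]
  have car: "carrier (quot X E) = carrier X // E" by (simp add: quot_def)
  have cls: "E `` {a} = E `` {b}" if "(a,b) \<in> E" for a b
    using equiv_class_eq[OF eq that] .
  have ball: "(\<forall>A\<in>carrier X // E. P A) \<longleftrightarrow> (\<forall>a\<in>carrier X. P (E `` {a}))" for P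
    by (auto simp: quotient_def)
  have inC: "a \<in> carrier X \<Longrightarrow> E `` {a} \<in> carrier X // E" for a by (rule quotientI)
  have uniq: "x = E `` {d a b}"
    if ab: "a \<in> carrier X" "b \<in> carrier X" and x: "x \<in> carrier X // E"
      "op (quot X E) x (E `` {b}) = E `` {a}" for x a b
  proof -
    from x(1) obtain y where y: "y \<in> carrier X" "x = E `` {y}" by (auto elim: quotientE)
    with x(2) ab have "E `` {op X y b} = E `` {a}" by (simp add: ops)
    hence "(op X y b, a) \<in> E" using eq_equiv_class_iff[OF eq] cl y ab by blast
    hence "(d (op X y b) b, d a b) \<in> E"
      unfolding E_def using ab by (intro gen_cong.bar gen_cong.refl) auto
    moreover have "(d (op X y b) b, y) \<in> E" using ax y ab by blast
    ultimately show ?thesis using cls y(2) by metis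
  qed
  have exi: "op (quot X E) (E `` {d a b}) (E `` {b}) = E `` {a}"
    if ab: "a \<in> carrier X" "b \<in> carrier X" for a b
    unfolding ops[OF conjunct1[OF conjunct2[OF cl[OF ab]]] ab(2)]
    by (rule cls) (use ax[OF ab ab(1)] in blast)
  show bar: "opbar (quot X E) (E `` {a}) (E `` {b}) = E `` {d a b}"
    if ab: "a \<in> carrier X" "b \<in> carrier X" for a b
    unfolding opbar_def car using uniq exi inC cl ab by (intro the_equality) auto
  have q1: "\<exists>!x. x \<in> carrier X // E \<and> op (quot X E) x (E `` {y}) = E `` {z}"
    if "y \<in> carrier X" "z \<in> carrier X" for y z
    using uniq[OF that(2,1)] exi[OF that(2,1)] inC[of "d z y"] cl[OF that(2,1)] by blast
  have q: "quandle (quot X E)"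
    unfolding quandle_def car ball
  proof (intro conjI ballI)
    fix x y z assume h: "x \<in> carrier X" "y \<in> carrier X" "z \<in> carrier X"
    note a = ax[OF h]
    show "op (quot X E) (op (quot X E) (E `` {x}) (E `` {y})) (E `` {z}) =
        op (quot X E) (op (quot X E) (E `` {x}) (E `` {z})) (op (quot X E) (E `` {y}) (E `` {z}))"
      by (simp only: ops cl h) (rule cls, use a in blast)
  next
    fix x assume h: "x \<in> carrier X"
    show "op (quot X E) (E `` {x}) (E `` {x}) = E `` {x}"
      by (simp only: ops cl h) (rule cls, use ax[OF h h h] in blast)
  next
    fix x y assume h: "x \<in> carrier X" "y \<in> carrier X"
    show "op (quot X E) (E `` {x}) (E `` {y}) \<in> carrier X // E"
      using inC cl[OF h] by (simp add: ops h)
  next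
    fix y z assume "y \<in> carrier X" "z \<in> carrier X"
    thus "\<exists>!x. x \<in> carrier X // E \<and> op (quot X E) x (E `` {y}) = E `` {z}" by (rule q1)
  qed
  have r: "R1 (quot X E) (E `` {a}) (E `` {b}) \<in> carrier X // E \<and>
      R2 (quot X E) (E `` {a}) (E `` {b}) \<in> carrier X // E"
    if h: "a \<in> carrier X" "b \<in> carrier X" for a b
    using inC cl[OF h] by (simp add: ops h)
  have e: "op (quot X E) (R1 (quot X E) (opbar (quot X E) (E `` {a}) (E `` {b})) (E `` {c})) (E `` {b}) =
         R1 (quot X E) (E `` {a}) (op (quot X E) (E `` {c}) (E `` {b})) \<and>
      R2 (quot X E) (opbar (quot X E) (E `` {a}) (E `` {b})) (E `` {c}) =
         opbar (quot X E) (R2 (quot X E) (E `` {a}) (op (quot X E) (E `` {c}) (E `` {b}))) (E `` {b}) \<and>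
      op (quot X E) (opbar (quot X E) (E `` {b}) (R1 (quot X E) (E `` {a}) (E `` {c}))) (E `` {a}) =
         opbar (quot X E) (op (quot X E) (E `` {b}) (R2 (quot X E) (E `` {a}) (E `` {c}))) (E `` {c}) \<and>
      R2 (quot X E) (E `` {a}) (E `` {b}) = R1 (quot X E) (E `` {b}) (op (quot X E) (E `` {a}) (E `` {b})) \<and>
      op (quot X E) (R1 (quot X E) (E `` {a}) (E `` {b})) (R2 (quot X E) (E `` {a}) (E `` {b})) =
         R2 (quot X E) (E `` {b}) (op (quot X E) (E `` {a}) (E `` {b}))"
    if h: "a \<in> carrier X" "b \<in> carrier X" "c \<in> carrier X" for a b c
    by (simp only: ops bar cl h) (intro conjI cls; use ax[OF h] in blast)
  show "singquandle (quot X E)"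
    unfolding singquandle_def car ball
    by (rule conjI[OF q conjI], intro ballI, erule (1) r, intro ballI, erule (2) e)
qed

lemma term_closed: "\<forall>a\<in>carrier (term_struct S). \<forall>b\<in>carrier (term_struct S).
      op (term_struct S) a b \<in> carrier (term_struct S) \<and> Bar a b \<in> carrier (term_struct S) \<and>
      R1 (term_struct S) a b \<in> carrier (term_struct S) \<and> R2 (term_struct S) a b \<in> carrier (term_struct S)"
  by (auto simp: term_struct_def)

lemma free_singquandle: "singquandle (free_sq S)"
  and free_opbar: "a \<in> carrier (term_struct S) \<Longrightarrow> b \<in> carrier (term_struct S) \<Longrightarrow>
      opbar (free_sq S) (free_cong S `` {a}) (free_cong S `` {b}) = free_cong S `` {Bar a b}"
proof -
  have ax: "\<forall>a\<in>carrier (term_struct S). \<forall>b\<in>carrier (term_struct S). \<forall>c\<in>carrier (term_struct S).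
        (op (term_struct S) a a, a) \<in> gen_cong (term_struct S) Bar sq_axioms \<and>
        (op (term_struct S) (Bar a b) b, a) \<in> gen_cong (term_struct S) Bar sq_axioms \<and>
        (Bar (op (term_struct S) a b) b, a) \<in> gen_cong (term_struct S) Bar sq_axioms \<and>
        (op (term_struct S) (op (term_struct S) a b) c, op (term_struct S) (op (term_struct S) a c) (op (term_struct S) b c)) \<in> gen_cong (term_struct S) Bar sq_axioms \<and>
        (op (term_struct S) (R1 (term_struct S) (Bar a b) c) b, R1 (term_struct S) a (op (term_struct S) c b)) \<in> gen_cong (term_struct S) Bar sq_axioms \<and>
        (R2 (term_struct S) (Bar a b) c, Bar (R2 (term_struct S) a (op (term_struct S) c b)) b) \<in> gen_cong (term_struct S) Bar sq_axioms \<and>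
        (op (term_struct S) (Bar b (R1 (term_struct S) a c)) a, Bar (op (term_struct S) b (R2 (term_struct S) a c)) c) \<in> gen_cong (term_struct S) Bar sq_axioms \<and>
        (R2 (term_struct S) a b, R1 (term_struct S) b (op (term_struct S) a b)) \<in> gen_cong (term_struct S) Bar sq_axioms \<and>
        (op (term_struct S) (R1 (term_struct S) a b) (R2 (term_struct S) a b), R2 (term_struct S) b (op (term_struct S) a b)) \<in> gen_cong (term_struct S) Bar sq_axioms"
    by (intro ballI conjI; rule gen_cong.base) (auto simp: term_struct_def intro: sq_axioms.intros)
  note Q = quot_singquandle[OF term_closed ax, folded free_cong_def free_sq_def]
  show "singquandle (free_sq S)" by (rule Q)
  show "a \<in> carrier (term_struct S) \<Longrightarrow> b \<in> carrier (term_struct S) \<Longrightarrow>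
      opbar (free_sq S) (free_cong S `` {a}) (free_cong S `` {b}) = free_cong S `` {Bar a b}"
    by (rule Q)
qed

lemma opbar_props:
  assumes "quandle X" "a \<in> carrier X" "b \<in> carrier X"
  shows "opbar X a b \<in> carrier X" "op X (opbar X a b) b = a"
    "\<And>x. x \<in> carrier X \<Longrightarrow> op X x b = a \<Longrightarrow> opbar X a b = x"
proof -
  have ex: "\<exists>!x. x \<in> carrier X \<and> op X x b = a" using assms by (simp add: quandle_def)
  show "opbar X a b \<in> carrier X" "op X (opbar X a b) b = a"
    unfolding opbar_def using theI'[OF ex] by auto
  show "opbar X a b = x" if "x \<in> carrier X" "op X x b = a" for x
    unfolding opbar_def using ex that by (intro the1_equality) auto
qed

lemma singquandleD:
  assumes "singquandle X"
  shows "quandle X"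
    and "\<And>a b. a \<in> carrier X \<Longrightarrow> b \<in> carrier X \<Longrightarrow> R1 X a b \<in> carrier X \<and> R2 X a b \<in> carrier X"
    and "\<And>a b c. a \<in> carrier X \<Longrightarrow> b \<in> carrier X \<Longrightarrow> c \<in> carrier X \<Longrightarrow>
        op X (R1 X (opbar X a b) c) b = R1 X a (op X c b) \<and>
        R2 X (opbar X a b) c = opbar X (R2 X a (op X c b)) b \<and>
        op X (opbar X b (R1 X a c)) a = opbar X (op X b (R2 X a c)) c \<and>
        R2 X a b = R1 X b (op X a b) \<and>
        op X (R1 X a b) (R2 X a b) = R2 X b (op X a b)"
  using assms unfolding singquandle_def by blast+

lemma sq_closed:
  assumes "singquandle X" "a \<in> carrier X" "b \<in> carrier X"
  shows "op X a b \<in> carrier X \<and> opbar X a b \<in> carrier X \<and> R1 X a b \<in> carrier X \<and> R2 X a b \<in> carrier X"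
proof -
  have q: "quandle X" by (rule singquandleD(1)[OF assms(1)])
  have "op X a b \<in> carrier X"
    using conjunct1[OF q[unfolded quandle_def]] assms(2,3) by blast
  thus ?thesis using singquandleD(2)[OF assms] opbar_props(1)[OF q assms(2,3)] by blast
qed

lemma sq_quot_singquandle:
  assumes X: "singquandle X"
  shows "singquandle (sq_quot X R)"
    and "a \<in> carrier X \<Longrightarrow> b \<in> carrier X \<Longrightarrow>
      opbar (sq_quot X R) (gen_cong X (opbar X) R `` {a}) (gen_cong X (opbar X) R `` {b})
        = gen_cong X (opbar X) R `` {opbar X a b}"
proof -
  have qX: "quandle X" using X by (rule singquandleD)
  have r: "(x, y) \<in> gen_cong X (opbar X) R" if "x = y" "x \<in> carrier X" for x y
    using that by (auto intro: gen_cong.refl)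
  note c = sq_closed[OF X]
  have cl: "\<forall>a\<in>carrier X. \<forall>b\<in>carrier X. op X a b \<in> carrier X \<and> opbar X a b \<in> carrier X \<and>
      R1 X a b \<in> carrier X \<and> R2 X a b \<in> carrier X" using c by blast
  have ax: "\<forall>a\<in>carrier X. \<forall>b\<in>carrier X. \<forall>c\<in>carrier X. (op X a a, a) \<in> gen_cong X (opbar X) R \<and> (op X (opbar X a b) b, a) \<in> gen_cong X (opbar X) R \<and> (opbar X (op X a b) b, a) \<in> gen_cong X (opbar X) R \<and>
      (op X (op X a b) c, op X (op X a c) (op X b c)) \<in> gen_cong X (opbar X) R \<and>
      (op X (R1 X (opbar X a b) c) b, R1 X a (op X c b)) \<in> gen_cong X (opbar X) R \<and>
      (R2 X (opbar X a b) c, opbar X (R2 X a (op X c b)) b) \<in> gen_cong X (opbar X) R \<and>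
      (op X (opbar X b (R1 X a c)) a, opbar X (op X b (R2 X a c)) c) \<in> gen_cong X (opbar X) R \<and>
      (R2 X a b, R1 X b (op X a b)) \<in> gen_cong X (opbar X) R \<and>
      (op X (R1 X a b) (R2 X a b), R2 X b (op X a b)) \<in> gen_cong X (opbar X) R" (is "\<forall>a\<in>_. \<forall>b\<in>_. \<forall>c\<in>_. ?ax a b c")
  proof (intro ballI)
    fix a b c assume h: "a \<in> carrier X" "b \<in> carrier X" "c \<in> carrier X"
    have e1: "op X a a = a" "op X (op X a b) c = op X (op X a c) (op X b c)"
      using qX h unfolding quandle_def by blast+
    have e2: "op X (opbar X a b) b = a" by (rule opbar_props[OF qX h(1,2)])
    have e3: "opbar X (op X a b) b = a" by (rule opbar_props(3)[OF qX _ h(2,1)]) (use h c in auto)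
    note A = singquandleD(3)[OF X h]
    note A = A[THEN conjunct1] A[THEN conjunct2, THEN conjunct1]
      A[THEN conjunct2, THEN conjunct2, THEN conjunct1]
      A[THEN conjunct2, THEN conjunct2, THEN conjunct2, THEN conjunct1]
      A[THEN conjunct2, THEN conjunct2, THEN conjunct2, THEN conjunct2]
    have k: "x \<in> carrier X \<Longrightarrow> y \<in> carrier X \<Longrightarrow> op X x y \<in> carrier X"
      "x \<in> carrier X \<Longrightarrow> y \<in> carrier X \<Longrightarrow> opbar X x y \<in> carrier X"
      "x \<in> carrier X \<Longrightarrow> y \<in> carrier X \<Longrightarrow> R1 X x y \<in> carrier X"
      "x \<in> carrier X \<Longrightarrow> y \<in> carrier X \<Longrightarrow> R2 X x y \<in> carrier X" for x y
      using c by blast+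
    show "?ax a b c" by (intro conjI r e1 e2 e3 A k h)
  qed
  note Q = quot_singquandle[OF cl ax, folded sq_quot_def]
  show "singquandle (sq_quot X R)" by (rule Q)
  show "a \<in> carrier X \<Longrightarrow> b \<in> carrier X \<Longrightarrow>
      opbar (sq_quot X R) (gen_cong X (opbar X) R `` {a}) (gen_cong X (opbar X) R `` {b})
        = gen_cong X (opbar X) R `` {opbar X a b}" by (rule Q)
qed

lemma singquandle_SQ: "singquandle (SQ D)"
  unfolding SQ_def by (rule sq_quot_singquandle[OF free_singquandle])

lemma hom_opbar:
  assumes "singquandle X" "singquandle Y" "f \<in> Hom X Y" "a \<in> carrier X" "b \<in> carrier X"
  shows "f (opbar X a b) = opbar Y (f a) (f b)"
proof -
  have q: "quandle X" "quandle Y" by (rule singquandleD(1), fact)+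
  note p = opbar_props(1,2)[OF q(1) assms(4,5)]
  have m: "f x \<in> carrier Y" if "x \<in> carrier X" for x
    using assms(3) that unfolding Hom_def by blast
  have "op Y (f (opbar X a b)) (f b) = f (op X (opbar X a b) b)"
    using assms(3,5) p(1) unfolding Hom_def by simp
  hence "op Y (f (opbar X a b)) (f b) = f a" by (simp only: p(2))
  from opbar_props(3)[OF q(2) m[OF assms(4)] m[OF assms(5)] m[OF p(1)] this]
  show ?thesis by (rule HOL.sym)
qed

lemma image_subsingquandle:
  assumes X: "singquandle X" and Y: "singquandle Y" and f: "f \<in> Hom X Y"
  shows "subsingquandle (f ` carrier X) Y"
proof -
  let ?Z = "Y\<lparr>carrier := f ` carrier X\<rparr>"
  have q: "quandle X" "quandle Y" by (rule singquandleD(1), fact)+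
  have fc: "f a \<in> carrier Y" if "a \<in> carrier X" for a using f that by (auto simp: Hom_def)
  have h: "f (op X a b) = op Y (f a) (f b)" "f (R1 X a b) = R1 Y (f a) (f b)"
    "f (R2 X a b) = R2 Y (f a) (f b)" if "a \<in> carrier X" "b \<in> carrier X" for a b
    using f that by (auto simp: Hom_def)
  note cX = sq_closed[OF X] and hb = hom_opbar[OF X Y f]
  have ex: "\<exists>!x. x \<in> f ` carrier X \<and> op Y x (f b) = f a" if ab: "a \<in> carrier X" "b \<in> carrier X" for a b
  proof (rule ex1I[of _ "f (opbar X a b)"])
    show "f (opbar X a b) \<in> f ` carrier X \<and> op Y (f (opbar X a b)) (f b) = f a"
      using cX[OF ab] hb[OF ab] opbar_props(2)[OF q(2) fc[OF ab(1)] fc[OF ab(2)]]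
      by (intro conjI imageI) simp_all
    show "x = f (opbar X a b)" if x: "x \<in> f ` carrier X \<and> op Y x (f b) = f a" for x
    proof -
      have "x \<in> carrier Y" "op Y x (f b) = f a" using x fc by blast+
      from opbar_props(3)[OF q(2) fc[OF ab(1)] fc[OF ab(2)] this]
      show ?thesis by (simp only: hb[OF ab])
    qed
  qed
  have ball: "(\<forall>x\<in>carrier ?Z. P x) \<longleftrightarrow> (\<forall>a\<in>carrier X. P (f a))" for P by simp
  have ops: "op ?Z = op Y" "R1 ?Z = R1 Y" "R2 ?Z = R2 Y" "carrier ?Z = f ` carrier X" by simp_all
  have Xq: "op X x x = x" "op X (op X x y) z = op X (op X x z) (op X y z)"
    if "x \<in> carrier X" "y \<in> carrier X" "z \<in> carrier X" for x y z
    using q(1) that unfolding quandle_def by blast+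
  have qZ: "quandle ?Z"
    unfolding quandle_def ball
  proof (intro conjI ballI)
    fix x y assume "x \<in> carrier X" "y \<in> carrier X"
    thus "op ?Z (f x) (f y) \<in> carrier ?Z" using cX by (simp add: ops h[symmetric])
  next
    fix x assume "x \<in> carrier X"
    thus "op ?Z (f x) (f x) = f x" using Xq(1) by (simp add: ops h[symmetric])
  next
    fix y z assume "y \<in> carrier X" "z \<in> carrier X"
    thus "\<exists>!x. x \<in> carrier ?Z \<and> op ?Z x (f y) = f z" using ex unfolding ops by blast
  next
    fix x y z assume a: "x \<in> carrier X" "y \<in> carrier X" "z \<in> carrier X"
    show "op ?Z (op ?Z (f x) (f y)) (f z) = op ?Z (op ?Z (f x) (f z)) (op ?Z (f y) (f z))"
      using Xq(2)[OF a] a cX by (simp add: ops h[symmetric])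
  qed
  have bar: "opbar ?Z (f a) (f b) = f (opbar X a b)" if "a \<in> carrier X" "b \<in> carrier X" for a b
  proof (rule opbar_props(3)[OF qZ])
    show "op ?Z (f (opbar X a b)) (f b) = f a"
      using opbar_props(2)[OF q(1) that] cX[OF that] that by (simp add: ops h[symmetric])
  qed (use that cX in \<open>auto simp: ops\<close>)
  have r: "R1 ?Z (f a) (f b) \<in> carrier ?Z \<and> R2 ?Z (f a) (f b) \<in> carrier ?Z"
    if "a \<in> carrier X" "b \<in> carrier X" for a b
    using cX[OF that] that by (simp add: ops h[symmetric])
  have e: "op ?Z (R1 ?Z (opbar ?Z (f a) (f b)) (f c)) (f b) = R1 ?Z (f a) (op ?Z (f c) (f b)) \<and>
        R2 ?Z (opbar ?Z (f a) (f b)) (f c) = opbar ?Z (R2 ?Z (f a) (op ?Z (f c) (f b))) (f b) \<and>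
        op ?Z (opbar ?Z (f b) (R1 ?Z (f a) (f c))) (f a) = opbar ?Z (op ?Z (f b) (R2 ?Z (f a) (f c))) (f c) \<and>
        R2 ?Z (f a) (f b) = R1 ?Z (f b) (op ?Z (f a) (f b)) \<and>
        op ?Z (R1 ?Z (f a) (f b)) (R2 ?Z (f a) (f b)) = R2 ?Z (f b) (op ?Z (f a) (f b))"
    if a: "a \<in> carrier X" "b \<in> carrier X" "c \<in> carrier X" for a b c
  proof -
    have o: "op ?Z (f a) (f b) = f (op X a b)" "R1 ?Z (f a) (f b) = f (R1 X a b)"
      "R2 ?Z (f a) (f b) = f (R2 X a b)" if "a \<in> carrier X" "b \<in> carrier X" for a b
      using h[OF that] by (simp_all add: ops)
    note A = singquandleD(3)[OF X a]
    have F: "f (op X (R1 X (opbar X a b) c) b) = f (R1 X a (op X c b)) \<and>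
        f (R2 X (opbar X a b) c) = f (opbar X (R2 X a (op X c b)) b) \<and>
        f (op X (opbar X b (R1 X a c)) a) = f (opbar X (op X b (R2 X a c)) c) \<and>
        f (R2 X a b) = f (R1 X b (op X a b)) \<and>
        f (op X (R1 X a b) (R2 X a b)) = f (R2 X b (op X a b))"
      using A by metis
    show ?thesis by (simp only: o bar cX a) (rule F)
  qed
  have "singquandle ?Z"
    unfolding singquandle_def ball
    by (rule conjI[OF qZ conjI], intro ballI, erule (1) r, intro ballI, erule (2) e)
  thus ?thesis using fc by (auto simp: subsingquandle_def)
qed

lemma finite_cuts:
  assumes "diagram D" shows "finite (cuts D)"
proof -
  have "finite (crossings D)" using assms by (simp add: diagram_def generic_immersion_def crossings_def)
  moreover have "cuts D \<subseteq> snd ` crossings D"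
    by (force simp: cuts_def over_under_def singular_crossing_def)
  ultimately show ?thesis by (meson finite_imageI finite_subset)
qed

lemma finite_arcs:
  assumes "diagram D" shows "finite (arcs D)"
proof -
  define P where "P = params (ncomp D) - cuts D"
  define k where "k = (\<lambda>(i::nat, t::real). (i, {s. (i, s) \<in> cuts D \<and> s < t}))"
  have eq: "arc_through D p = arc_through D q" if "p \<in> P" "q \<in> P" "k p = k q" for p q
  proof -
    obtain i t t' where p: "p = (i, t)" and q: "q = (i, t')"
      using \<open>k p = k q\<close> by (cases p; cases q) (auto simp: k_def)
    have sub: "arc_through D (i, t) \<subseteq> arc_through D (i, t')"
      if "(i, t) \<in> P" "(i, t') \<in> P" "k (i, t) = k (i, t')" for t t'
    proof -
      have r01: "0 \<le> t" "t < 1" "0 \<le> t'" "t' < 1" using that by (auto simp: P_def params_def)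
      have S: "(i, s) \<in> cuts D \<Longrightarrow> s < t \<longleftrightarrow> s < t'" for s
        using that(3) unfolding k_def by (simp add: set_eq_iff) blast
      have gap: "(i, frac r) \<notin> cuts D" if "r \<in> closed_segment t t'" for r
      proof -
        have "0 \<le> r" "r < 1" using that r01 by (auto simp: closed_segment_eq_real_ivl split: if_splits)
        hence "frac r = r" by (simp add: frac_eq)
        moreover have "(i, r) \<notin> cuts D"
        proof
          assume c: "(i, r) \<in> cuts D"
          have "r \<noteq> t" "r \<noteq> t'" using c \<open>(i,t)\<in>P\<close> \<open>(i,t')\<in>P\<close> by (auto simp: P_def)
          with S[OF c] \<open>r \<in> closed_segment t t'\<close> show False
            by (auto simp: closed_segment_eq_real_ivl split: if_splits)
        qed
        ultimately show ?thesis by simp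
      qed
      have seg: "closed_segment t' x \<subseteq> closed_segment t t' \<union> closed_segment t x" for x :: real
        by (auto simp: closed_segment_eq_real_ivl)
      have "\<exists>m::int. \<forall>r\<in>closed_segment t' (s + of_int m). (i, frac r) \<notin> cuts D"
        if "\<exists>m::int. \<forall>r\<in>closed_segment t (s + of_int m). (i, frac r) \<notin> cuts D" for s
        using that gap seg by (meson UnE subsetD)
      thus ?thesis unfolding arc_through_def by blast
    qed
    show ?thesis using sub[of t t'] sub[of t' t] that unfolding p q by auto
  qed
  have "k ` P \<subseteq> {..<ncomp D} \<times> Pow (snd ` cuts D)"
    by (force simp: k_def P_def params_def)
  hence fin: "finite (k ` P)" using finite_cuts[OF assms] by (meson finite_Pow_iff finite_SigmaI finite_imageI finite_lessThan finite_subset)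
  have "arcs D \<subseteq> (\<lambda>x. arc_through D (SOME p. p \<in> P \<and> k p = x)) ` k ` P"
  proof
    fix A assume "A \<in> arcs D"
    then obtain p where p: "p \<in> P" "A = arc_through D p" by (auto simp: arcs_def P_def)
    have "(SOME q. q \<in> P \<and> k q = k p) \<in> P \<and> k (SOME q. q \<in> P \<and> k q = k p) = k p"
      by (rule someI[of _ p]) (use p in simp)
    with eq p show "A \<in> (\<lambda>x. arc_through D (SOME p. p \<in> P \<and> k p = x)) ` k ` P" by blast
  qed
  thus ?thesis using fin by (meson finite_imageI finite_subset)
qed

lemma hom_eqI:
  assumes T: "singquandle T" and fg: "f \<in> Hom (sq_quot (free_sq S) R) T" "g \<in> Hom (sq_quot (free_sq S) R) T"
    and gen: "\<And>x. x \<in> S \<Longrightarrow> f (gen_cong (free_sq S) (opbar (free_sq S)) R `` {free_gen S x})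
                        = g (gen_cong (free_sq S) (opbar (free_sq S)) R `` {free_gen S x})"
  shows "f = g"
proof -
  let ?F = "free_sq S" and ?Q = "sq_quot (free_sq S) R" and ?t = "term_struct S"
  let ?E = "gen_cong ?F (opbar ?F) R" 
  define c where "c t = ?E `` {free_cong S `` {t}}" for t
  have Q: "singquandle ?Q" by (rule sq_quot_singquandle[OF free_singquandle])
  have carF: "carrier ?F = carrier ?t // free_cong S" by (simp add: free_sq_def quot_def)
  have carQ: "carrier ?Q = carrier ?F // ?E" by (simp add: sq_quot_def quot_def)
  have inF: "free_cong S `` {t} \<in> carrier ?F" if "t \<in> carrier ?t" for t
    using that by (simp add: carF quotientI)
  have inQ: "c t \<in> carrier ?Q" if "t \<in> carrier ?t" for t
    using inF[OF that] by (simp add: carQ c_def quotientI)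
  have clF: "\<forall>a\<in>carrier ?F. \<forall>b\<in>carrier ?F. op ?F a b \<in> carrier ?F \<and> opbar ?F a b \<in> carrier ?F \<and>
      R1 ?F a b \<in> carrier ?F \<and> R2 ?F a b \<in> carrier ?F"
    using sq_closed[OF free_singquandle] by blast
  note o1 = quot_ops[OF term_closed[of S], where R = sq_axioms, folded free_cong_def free_sq_def]
  note o2 = quot_ops[OF clF, where R = R, folded sq_quot_def]
  have opsc: "op ?Q (c a) (c b) = c (Op a b)" "R1 ?Q (c a) (c b) = c (T1 a b)"
    "R2 ?Q (c a) (c b) = c (T2 a b)" "opbar ?Q (c a) (c b) = c (Bar a b)"
    if "a \<in> carrier ?t" "b \<in> carrier ?t" for a b
    using that inF o1[OF that] o2[OF inF[OF that(1)] inF[OF that(2)]] free_opbar[OF that]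
      sq_quot_singquandle(2)[OF free_singquandle inF[OF that(1)] inF[OF that(2)], of R]
    by (simp_all add: c_def term_struct_def)
  have main: "set_sq_term t \<subseteq> S \<Longrightarrow> f (c t) = g (c t)" for t
  proof (induction t)
    case (Gen x) thus ?case using gen by (simp add: c_def free_gen_def)
  next
    case (Op a b)
    hence m: "a \<in> carrier ?t" "b \<in> carrier ?t" by (auto simp: term_struct_def)
    have "f (op ?Q (c a) (c b)) = op T (f (c a)) (f (c b))" "g (op ?Q (c a) (c b)) = op T (g (c a)) (g (c b))"
      using fg inQ m by (simp_all add: Hom_def)
    thus ?case using Op m by (simp add: opsc)
  next
    case (Bar a b)
    hence m: "a \<in> carrier ?t" "b \<in> carrier ?t" by (auto simp: term_struct_def)
    show ?case using Bar hom_opbar[OF Q T fg(1) inQ[OF m(1)] inQ[OF m(2)]]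
        hom_opbar[OF Q T fg(2) inQ[OF m(1)] inQ[OF m(2)]] m by (simp add: opsc)
  next
    case (T1 a b)
    hence m: "a \<in> carrier ?t" "b \<in> carrier ?t" by (auto simp: term_struct_def)
    have "f (R1 ?Q (c a) (c b)) = R1 T (f (c a)) (f (c b))" "g (R1 ?Q (c a) (c b)) = R1 T (g (c a)) (g (c b))"
      using fg inQ m by (simp_all add: Hom_def)
    thus ?case using T1 m by (simp add: opsc)
  next
    case (T2 a b)
    hence m: "a \<in> carrier ?t" "b \<in> carrier ?t" by (auto simp: term_struct_def)
    have "f (R2 ?Q (c a) (c b)) = R2 T (f (c a)) (f (c b))" "g (R2 ?Q (c a) (c b)) = R2 T (g (c a)) (g (c b))"
      using fg inQ m by (simp_all add: Hom_def)
    thus ?case using T2 m by (simp add: opsc)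
  qed
  show "f = g"
  proof (rule PiE_ext)
    show "f \<in> carrier ?Q \<rightarrow>\<^sub>E carrier T" "g \<in> carrier ?Q \<rightarrow>\<^sub>E carrier T" using fg by (auto simp: Hom_def)
    fix A assume "A \<in> carrier ?Q"
    then obtain t where "t \<in> carrier ?t" "A = c t"
      unfolding carQ carF c_def by (auto elim!: quotientE)
    thus "f A = g A" using main by (simp add: term_struct_def)
  qed
qed

lemma finite_Hom_SQ:
  assumes "diagram D" "singquandle T" "finite (carrier T)"
  shows "finite (Hom (SQ D) T)"
proof -
  let ?F = "free_sq (arcs D)"
  let ?g = "\<lambda>x. gen_cong ?F (opbar ?F) (crossing_rels D) `` {free_gen (arcs D) x}"
  let ?r = "\<lambda>f. restrict (f \<circ> ?g) (arcs D)"
  have inj: "inj_on ?r (Hom (SQ D) T)"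
  proof (rule inj_onI)
    fix f g assume fg: "f \<in> Hom (SQ D) T" "g \<in> Hom (SQ D) T" "?r f = ?r g"
    have "f (?g x) = g (?g x)" if "x \<in> arcs D" for x
      using fun_cong[OF fg(3), of x] that by simp
    thus "f = g" by (rule hom_eqI[OF assms(2) fg(1,2)[unfolded SQ_def]])
  qed
  have gc: "?g x \<in> carrier (SQ D)" if "x \<in> arcs D" for x
    using that by (auto simp: SQ_def sq_quot_def quot_def free_sq_def free_gen_def term_struct_def intro!: quotientI)
  have "?r ` Hom (SQ D) T \<subseteq> arcs D \<rightarrow>\<^sub>E carrier T"
    using gc by (auto simp: Hom_def PiE_iff)
  moreover have "finite (arcs D \<rightarrow>\<^sub>E carrier T)"
    using finite_arcs[OF assms(1)] assms(3) by (intro finite_PiE) auto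
  ultimately show ?thesis using inj by (meson finite_imageD finite_subset)
qed

end

theory Submission
  imports Defs
begin

text \<open>
  Setting all variables to \<open>0\<close> in a polynomial leaves its constant term, so the first equation says
  that no subsingquandle polynomial of an image \<open>Im(f)\<close> has a constant term.  The reason is
  idempotence of a quandle: \<open>x * x = x\<close> puts \<open>x\<close> itself among the \<open>y\<close> with \<open>x * y = x\<close>, so
  \<open>r\<^sup>1(x) \<ge> 1\<close> and the monomial contributed by \<open>x\<close> is divisible by \<open>s\<^sub>1\<close>
  (\<open>Ssqp_constant_term\<close>).  Substitution in the exponents is additive on formal sums, so every
  homomorphism contributes \<open>u\<^sup>0\<close>.  Finally \<open>u\<^sup>0\<close> is the unit of the monoid ring, so the sum
  of these contributions counts the homomorphisms.
\<close>

text \<open>Every monomial other than \<open>1\<close> involves some variable and so vanishes at the origin.\<close>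

lemma eval_poly_zero: "eval_poly (\<lambda>_. 0) p = Poly_Mapping.lookup p 0"
proof -
  have "(\<Prod>v\<in>Poly_Mapping.keys m. (0::int) ^ Poly_Mapping.lookup m v) = (if m = 0 then 1 else 0)"
    for m :: "var \<Rightarrow>\<^sub>0 nat"
  proof (cases "m = 0")
    case False
    then obtain v where "v \<in> Poly_Mapping.keys m"
      by (metis all_not_in_conv keys_eq_empty)
    then have "\<exists>v\<in>Poly_Mapping.keys m. (0::int) ^ Poly_Mapping.lookup m v = 0"
      by (auto simp: in_keys_iff)
    with False show ?thesis
      by (simp only: if_False prod_zero[OF finite_keys])
  qed simp
  then have "eval_poly (\<lambda>_. 0) p =
      (\<Sum>m\<in>Poly_Mapping.keys p. if m = 0 then Poly_Mapping.lookup p m else 0)"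
    unfolding eval_poly_def by (intro sum.cong) auto
  then show ?thesis
    by (simp add: sum.delta in_keys_iff)
qed

lemma lookup_V_mult_zero: "Poly_Mapping.lookup (V v * p) 0 = 0"
proof -
  have "0 \<notin> Poly_Mapping.keys (V v * p)"
  proof
    assume "0 \<in> Poly_Mapping.keys (V v * p)"
    then obtain b where "0 = Poly_Mapping.single v (1::nat) + b"
      using keys_mult[of "V v" p] by (auto simp: V_def)
    then have "Poly_Mapping.lookup (Poly_Mapping.single v (1::nat) + b) v = 0"
      by (metis lookup_zero)
    then show False
      by (simp add: lookup_add)
  qed
  then show ?thesis
    by (simp add: in_keys_iff)
qed

text \<open>Finiteness matters: over an infinite set of witnesses \<open>y\<close>, \<open>card\<close> would give \<open>r1 X x = 0\<close>.\<close>

lemma r1_pos: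
  assumes "quandle X" "finite (carrier X)" "x \<in> carrier X"
  shows "r1 X x > 0"
proof -
  have "x \<in> {y \<in> carrier X. op X x y = x}"
    using assms by (simp add: quandle_def)
  then show ?thesis
    unfolding r1_def using assms(2) by (subst card_gt_0_iff) auto
qed

lemma Ssqp_constant_term:
  assumes "quandle X" "finite (carrier X)" "S \<subseteq> carrier X"
  shows "Poly_Mapping.lookup (Ssqp S X) 0 = 0"
proof -
  have "Poly_Mapping.lookup (V s1 ^ r1 X x * V t1 ^ c1 X x * V s2 ^ r2 X x * V t2 ^ c2 X x *
      V s3 ^ r3 X x * V t3 ^ c3 X x) 0 = 0" if "x \<in> S" for x
  proof -
    obtain k where "r1 X x = Suc k"
      using r1_pos assms \<open>x \<in> S\<close> by (metis gr0_conv_Suc subsetD)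
    then show ?thesis
      by (simp add: mult.assoc lookup_V_mult_zero)
  qed
  then show ?thesis
    by (simp add: Ssqp_def lookup_sum)
qed

lemma u_pow_zero: "u_pow 0 = 1"
  by (simp add: u_pow_def)

theorem mainTheorem2:
  fixes L D :: sing_link and T :: "'a sq_struct"
  assumes "oriented_singular_link L"
    and "diagram_of D L"
    and "singquandle T"
    and "finite (carrier T)"
  shows "subst_exponents (\<lambda>_. 0) (phi_Ssqp D T) = (\<Sum>f\<in>Hom (SQ D) T. u_pow 0) \<and>
    (\<Sum>f\<in>Hom (SQ D) T. u_pow (0::int)) = of_nat (counting_invariant D T)"
proof
  have fin: "finite (Hom (SQ D) T)"
    using assms by (intro finite_Hom_SQ) (simp_all add: diagram_of_def)
  have ev: "eval_poly (\<lambda>_. 0) (Ssqp (f ` carrier (SQ D)) T) = 0" if "f \<in> Hom (SQ D) T" for f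
  proof -
    have "f ` carrier (SQ D) \<subseteq> carrier T"
      using that by (auto simp: Hom_def)
    then show ?thesis
      using Ssqp_constant_term singquandleD(1) assms(3,4) by (metis eval_poly_zero)
  qed
  have "subst_exponents (\<lambda>_. 0) (phi_Ssqp D T) =
      (\<Sum>f\<in>Hom (SQ D) T. u_pow (eval_poly (\<lambda>_. 0) (Ssqp (f ` carrier (SQ D)) T)))"
    unfolding subst_exponents_def phi_Ssqp_def
    by (simp add: frag_extend_sum[OF fin] o_def u_pow_def)
  then show "subst_exponents (\<lambda>_. 0) (phi_Ssqp D T) = (\<Sum>f\<in>Hom (SQ D) T. u_pow 0)"
    by (simp add: ev)
  show "(\<Sum>f\<in>Hom (SQ D) T. u_pow (0::int)) = of_nat (counting_invariant D T)"
    by (simp add: u_pow_zero counting_invariant_def)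
qed

end
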